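(* For any topological monoid $(S,\tau)$ with zero and any finite cardinal $\lambda\geqslant 1$ there exists a unique topological Brandt $\lambda^0$-extension $(B^0_\lambda(S),\tau_B)$ of $(S,\tau)$. Its topology $\tau_B$ is generated by the base $\mathscr{B}_B=\bigcup\{\mathscr{B}_B(t): t\in B^0_\lambda(S)\}$, where, with $\mathscr{B}_S(s)$ denoting a base of the topology $\tau$ at the point $s\in S$: (i) $\mathscr{B}_B(t)=\{U_{\alpha,\beta}\setminus\{0\}: U\in\mathscr{B}_S(s)\}$ if $t=(\alpha,s,\beta)$ is a non-zero element of $B^0_\lambda(S)$, $\alpha,\beta\in I_\lambda$; (ii) $\mathscr{B}_B(0)=\bigl\{\bigcup_{\alpha,\beta\in I_\lambda}U_{\alpha,\beta}: U\in\mathscr{B}_S(0_S)\bigr\}$, where $0$ is the zero of $B^0_\lambda(S)$. Moreover, for any finite cardinal $\lambda\geqslant 1$, a topological monoid $(S,\tau)$ with zero is a topological inverse semigroup if and only if $(B^0_\lambda(S),\tau_B)$ is the topological Brandt $\lambda^0$-extension of $(S,\tau)$ in the class of topological inverse semigroups.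
   Context: All topological spaces are Hausdorff; a topological semigroup is a semigroup with a topology making multiplication jointly continuous; a topological inverse semigroup is a topological semigroup that is an inverse semigroup with continuous inversion. $I_\lambda$ denotes a set of cardinality $\lambda\geqslant 1$. For a semigroup $S$ with zero $0_S$, the Brandt $\lambda^0$-extension $B^0_\lambda(S)$ is the set $\{(\alpha,s,\beta):\alpha,\beta\in I_\lambda,\ s\in S\setminus\{0_S\}\}\cup\{0\}$ with multiplication $(\alpha,a,\beta)(\gamma,b,\delta)=(\alpha,ab,\delta)$ if $\beta=\gamma$ and $ab\neq 0_S$, all other products being equal to $0$. For $A\subseteq S$ put $A_{\alpha,\beta}=\{(\alpha,s,\beta):s\in A\}$ if $0_S\notin A$, and $A_{\alpha,\beta}=\{(\alpha,s,\beta):s\in A\setminus\{0_S\}\}\cup\{0\}$ if $0_S\in A$. If $(S,\tau)$ is a topological monoid with zero, a topological Brandt $\lambda^0$-extension of $(S,\tau)$ (resp. in the class of topological inverse semigroups) is $(B^0_\lambda(S),\tau_B)$ where $\tau_B$ is a topology making $B^0_\lambda(S)$ a topological semigroup (resp. making it a topological inverse semigroup, with $(S,\tau)$ itself a topological inverse semigroup) and such that for some $\alpha\in I_\lambda$ the subspace topology on $S_{\alpha,\alpha}$ coincides with $\tau$ under the identification $s\mapsto(\alpha,s,\alpha)$, $0_S\mapsto 0$. *)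

theory Defs
  imports "HOL-Analysis.Analysis" "HOL-Algebra.Group"
begin

definition semigroup_on :: "'a set \<Rightarrow> ('a \<Rightarrow> 'a \<Rightarrow> 'a) \<Rightarrow> bool" where
  "semigroup_on C f \<longleftrightarrow>
     (\<forall>x\<in>C. \<forall>y\<in>C. f x y \<in> C) \<and>
     (\<forall>x\<in>C. \<forall>y\<in>C. \<forall>w\<in>C. f (f x y) w = f x (f y w))"

definition inverse_of :: "'a set \<Rightarrow> ('a \<Rightarrow> 'a \<Rightarrow> 'a) \<Rightarrow> 'a \<Rightarrow> 'a \<Rightarrow> bool" where
  "inverse_of C f x y \<longleftrightarrow> y \<in> C \<and> f (f x y) x = x \<and> f (f y x) y = y"

definition inverse_semigroup_on :: "'a set \<Rightarrow> ('a \<Rightarrow> 'a \<Rightarrow> 'a) \<Rightarrow> bool" where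
  "inverse_semigroup_on C f \<longleftrightarrow>
     semigroup_on C f \<and> (\<forall>x\<in>C. \<exists>!y. inverse_of C f x y)"

text \<open>All topological spaces are Hausdorff by convention, so this is part of the next definition.\<close>

definition topological_semigroup ::
    "'a set \<Rightarrow> ('a \<Rightarrow> 'a \<Rightarrow> 'a) \<Rightarrow> 'a topology \<Rightarrow> bool" where
  "topological_semigroup C f T \<longleftrightarrow>
     semigroup_on C f \<and> topspace T = C \<and> Hausdorff_space T \<and>
     continuous_map (prod_topology T T) T (\<lambda>(x, y). f x y)"

definition topological_inverse_semigroup ::
    "'a set \<Rightarrow> ('a \<Rightarrow> 'a \<Rightarrow> 'a) \<Rightarrow> 'a topology \<Rightarrow> bool" where
  "topological_inverse_semigroup C f T \<longleftrightarrow>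
     topological_semigroup C f T \<and> inverse_semigroup_on C f \<and>
     continuous_map T T (\<lambda>x. THE y. inverse_of C f x y)"

definition topological_monoid_with_zero ::
    "('s, 'm) monoid_scheme \<Rightarrow> 's \<Rightarrow> 's topology \<Rightarrow> bool" where
  "topological_monoid_with_zero S z T \<longleftrightarrow>
     monoid S \<and> topological_semigroup (carrier S) (mult S) T \<and>
     z \<in> carrier S \<and> (\<forall>x\<in>carrier S. z \<otimes>\<^bsub>S\<^esub> x = z \<and> x \<otimes>\<^bsub>S\<^esub> z = z)"

text \<open>
  In the Brandt extension of a semigroup \<open>S\<close> with zero \<open>z\<close> over the index set \<open>I\<close>, the triple
  \<open>(\<alpha>, s, \<beta>)\<close> is \<open>Some (\<alpha>, s, \<beta>)\<close> and the adjoined zero is \<open>None\<close>.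
\<close>

definition brandt_carrier ::
    "'i set \<Rightarrow> ('s, 'm) monoid_scheme \<Rightarrow> 's \<Rightarrow> ('i \<times> 's \<times> 'i) option set" where
  "brandt_carrier I S z =
     {Some (\<alpha>, s, \<beta>) | \<alpha> s \<beta>. \<alpha> \<in> I \<and> \<beta> \<in> I \<and> s \<in> carrier S - {z}} \<union> {None}"

fun brandt_mult ::
    "('s, 'm) monoid_scheme \<Rightarrow> 's \<Rightarrow>
     ('i \<times> 's \<times> 'i) option \<Rightarrow> ('i \<times> 's \<times> 'i) option \<Rightarrow> ('i \<times> 's \<times> 'i) option" where
  "brandt_mult S z (Some (\<alpha>, a, \<beta>)) (Some (\<gamma>, b, \<delta>)) =
     (if \<beta> = \<gamma> \<and> a \<otimes>\<^bsub>S\<^esub> b \<noteq> z then Some (\<alpha>, a \<otimes>\<^bsub>S\<^esub> b, \<delta>) else None)"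
| "brandt_mult S z None q = None"
| "brandt_mult S z p None = None"

text \<open>\<open>brandt_block z A \<alpha> \<beta>\<close> is the set \<open>A\<close> with subscripts \<open>\<alpha>, \<beta>\<close>.\<close>

definition brandt_block :: "'s \<Rightarrow> 's set \<Rightarrow> 'i \<Rightarrow> 'i \<Rightarrow> ('i \<times> 's \<times> 'i) option set" where
  "brandt_block z A \<alpha> \<beta> =
     (if z \<in> A then {Some (\<alpha>, s, \<beta>) | s. s \<in> A - {z}} \<union> {None}
      else {Some (\<alpha>, s, \<beta>) | s. s \<in> A})"

definition brandt_embed :: "'s \<Rightarrow> 'i \<Rightarrow> 's \<Rightarrow> ('i \<times> 's \<times> 'i) option" where
  "brandt_embed z \<alpha> s = (if s = z then None else Some (\<alpha>, s, \<alpha>))"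

definition extends_topology ::
    "'i set \<Rightarrow> ('s, 'm) monoid_scheme \<Rightarrow> 's \<Rightarrow> 's topology \<Rightarrow>
     ('i \<times> 's \<times> 'i) option topology \<Rightarrow> bool" where
  "extends_topology I S z T TB \<longleftrightarrow>
     (\<exists>\<alpha>\<in>I. homeomorphic_map T (subtopology TB (brandt_block z (carrier S) \<alpha> \<alpha>))
              (brandt_embed z \<alpha>))"

definition topological_brandt_extension ::
    "'i set \<Rightarrow> ('s, 'm) monoid_scheme \<Rightarrow> 's \<Rightarrow> 's topology \<Rightarrow>
     ('i \<times> 's \<times> 'i) option topology \<Rightarrow> bool" where
  "topological_brandt_extension I S z T TB \<longleftrightarrow>
     topological_semigroup (brandt_carrier I S z) (brandt_mult S z) TB \<and>
     extends_topology I S z T TB"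

definition topological_inverse_brandt_extension ::
    "'i set \<Rightarrow> ('s, 'm) monoid_scheme \<Rightarrow> 's \<Rightarrow> 's topology \<Rightarrow>
     ('i \<times> 's \<times> 'i) option topology \<Rightarrow> bool" where
  "topological_inverse_brandt_extension I S z T TB \<longleftrightarrow>
     topological_inverse_semigroup (carrier S) (mult S) T \<and>
     topological_inverse_semigroup (brandt_carrier I S z) (brandt_mult S z) TB \<and>
     extends_topology I S z T TB"

definition open_base_at :: "'a topology \<Rightarrow> 'a \<Rightarrow> 'a set set \<Rightarrow> bool" where
  "open_base_at T x \<B> \<longleftrightarrow>
     (\<forall>U\<in>\<B>. openin T U \<and> x \<in> U) \<and>
     (\<forall>W. openin T W \<and> x \<in> W \<longrightarrow> (\<exists>U\<in>\<B>. U \<subseteq> W))"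

fun brandt_base_at ::
    "'i set \<Rightarrow> 's \<Rightarrow> ('s \<Rightarrow> 's set set) \<Rightarrow>
     ('i \<times> 's \<times> 'i) option \<Rightarrow> ('i \<times> 's \<times> 'i) option set set" where
  "brandt_base_at I z BS (Some (\<alpha>, s, \<beta>)) = {brandt_block z U \<alpha> \<beta> - {None} | U. U \<in> BS s}"
| "brandt_base_at I z BS None = {(\<Union>\<alpha>\<in>I. \<Union>\<beta>\<in>I. brandt_block z U \<alpha> \<beta>) | U. U \<in> BS z}"

definition brandt_base ::
    "'i set \<Rightarrow> ('s, 'm) monoid_scheme \<Rightarrow> 's \<Rightarrow> ('s \<Rightarrow> 's set set) \<Rightarrow>
     ('i \<times> 's \<times> 'i) option set set" where
  "brandt_base I S z BS = (\<Union>t\<in>brandt_carrier I S z. brandt_base_at I z BS t)"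

end

theory Submission
  imports Defs
begin

text \<open>
  Think of \<open>(\<alpha>, s, \<beta>)\<close> as the matrix whose only non-zero entry is \<open>s\<close>, at position \<open>(\<alpha>, \<beta>)\<close>.
  Multiplying by matrix units on both sides moves the block \<open>(\<alpha>, \<alpha>)\<close> to any other block and
  projects onto any block. Hence in every topological Brandt extension all the insertions
  \<open>s \<mapsto> (\<alpha>, s, \<beta>)\<close> and all the entry maps are continuous. Since there are finitely many
  blocks, this determines the topology: it is final for the insertions and initial
  for the entry maps. Conversely, for this topology the continuity of multiplication and of
  inversion can be tested on entries.
\<close>

section \<open>Matrix units and entries\<close>

text \<open>Sending \<open>z\<close> to \<open>None\<close> makes the insertion total on S, so
  products of units can be computed without separating zero from non-zero elements. On the diagonal
  it is the embedding from the definition of an extension.\<close>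

definition brandt_unit :: "'s \<Rightarrow> 'i \<Rightarrow> 'i \<Rightarrow> 's \<Rightarrow> ('i \<times> 's \<times> 'i) option" where
  "brandt_unit z \<alpha> \<beta> s = (if s = z then None else Some (\<alpha>, s, \<beta>))"

fun brandt_entry :: "'s \<Rightarrow> 'i \<Rightarrow> 'i \<Rightarrow> ('i \<times> 's \<times> 'i) option \<Rightarrow> 's" where
  "brandt_entry z \<alpha> \<beta> None = z"
| "brandt_entry z \<alpha> \<beta> (Some (\<gamma>, s, \<delta>)) = (if \<alpha> = \<gamma> \<and> \<beta> = \<delta> then s else z)"

lemma brandt_unit_zero [simp]: "brandt_unit z \<alpha> \<beta> z = None"
  by (simp add: brandt_unit_def)

lemma brandt_entry_unit [simp]:
  "brandt_entry z \<alpha> \<beta> (brandt_unit z \<gamma> \<delta> s) = (if \<alpha> = \<gamma> \<and> \<beta> = \<delta> then s else z)"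
  by (simp add: brandt_unit_def)

lemma brandt_embed_eq_unit: "brandt_embed z \<alpha> = brandt_unit z \<alpha> \<alpha>"
  by (auto simp: brandt_embed_def brandt_unit_def)

lemma brandt_unit_eq_None_iff [simp]:
  "brandt_unit z \<alpha> \<beta> s = None \<longleftrightarrow> s = z"
  "None = brandt_unit z \<alpha> \<beta> s \<longleftrightarrow> s = z"
  by (auto simp: brandt_unit_def)

text \<open>Points of a T1 space are closed, so \<open>V - {c}\<close> is still open. With
  \<open>c = z\<close> this makes "the entry is non-zero and lies in \<open>V\<close>" an open
  condition.\<close>

lemma continuous_map_preimage_diff_point:
  assumes "continuous_map X Y f" "t1_space Y" "openin Y V" "c \<in> topspace Y"
  shows "openin X {x \<in> topspace X. f x \<in> V - {c}}"
  using assms by (intro openin_continuous_map_preimage[OF assms(1)])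
    (simp add: openin_diff closedin_t1_singleton)

locale brandt_setting =
  fixes S :: "('s, 'm) monoid_scheme" (structure) and z :: 's and T :: "'s topology" and I :: "'i set"
  assumes topological_monoid: "topological_monoid_with_zero S z T"
    and finite_index: "finite I" and index_nonempty: "I \<noteq> {}"
begin

sublocale monoid S
  using topological_monoid by (simp add: topological_monoid_with_zero_def)

lemma zero_closed [simp]: "z \<in> carrier S"
  and zero_mult [simp]: "x \<in> carrier S \<Longrightarrow> z \<otimes> x = z"
  and mult_zero [simp]: "x \<in> carrier S \<Longrightarrow> x \<otimes> z = z"
  and topspace_T [simp]: "topspace T = carrier S"
  and Hausdorff_T: "Hausdorff_space T"
  and semigroup_carrier: "semigroup_on (carrier S) (mult S)"
  and continuous_mult: "continuous_map (prod_topology T T) T (\<lambda>(x, y). x \<otimes> y)"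
  using topological_monoid
  by (auto simp: topological_monoid_with_zero_def topological_semigroup_def)

lemma t1_T: "t1_space T"
  using Hausdorff_T by (rule Hausdorff_imp_t1_space)

lemma continuous_map_mult:
  assumes "continuous_map Y T f" "continuous_map Y T g"
  shows "continuous_map Y T (\<lambda>y. f y \<otimes> g y)"
proof -
  have "continuous_map Y (prod_topology T T) (\<lambda>y. (f y, g y))"
    using assms by (simp add: continuous_map_pairedI)
  from continuous_map_compose[OF this continuous_mult] show ?thesis
    by (simp add: o_def)
qed

section \<open>Algebra of the Brandt extension in coordinates\<close>

abbreviation B :: "('i \<times> 's \<times> 'i) option set" where
  "B \<equiv> brandt_carrier I S z"

abbreviation unit :: "'i \<Rightarrow> 'i \<Rightarrow> 's \<Rightarrow> ('i \<times> 's \<times> 'i) option" where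
  "unit \<equiv> brandt_unit z"

abbreviation entry :: "'i \<Rightarrow> 'i \<Rightarrow> ('i \<times> 's \<times> 'i) option \<Rightarrow> 's" where
  "entry \<equiv> brandt_entry z"

abbreviation bmult (infixl "\<odot>" 70) where
  "x \<odot> y \<equiv> brandt_mult S z x y"

lemma None_in_B [simp]: "None \<in> B"
  by (simp add: brandt_carrier_def)

lemma unit_in_B [simp]: "\<lbrakk>\<alpha> \<in> I; \<beta> \<in> I; s \<in> carrier S\<rbrakk> \<Longrightarrow> unit \<alpha> \<beta> s \<in> B"
  by (auto simp: brandt_carrier_def brandt_unit_def)

lemma entry_closed [simp]: "p \<in> B \<Longrightarrow> entry \<alpha> \<beta> p \<in> carrier S"
  by (auto simp: brandt_carrier_def)

text \<open>\<open>None\<close> is covered as well: it is the unit with entry \<open>z\<close> at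
  any position, and a position exists because \<open>I\<close> is non-empty.\<close>

lemma B_cases:
  assumes "p \<in> B"
  obtains \<alpha> \<beta> s where "\<alpha> \<in> I" "\<beta> \<in> I" "s \<in> carrier S" "p = unit \<alpha> \<beta> s"
proof (cases p)
  case None
  with index_nonempty that zero_closed show ?thesis
    by (metis brandt_unit_zero ex_in_conv)
next
  case (Some q)
  with assms that show ?thesis
    by (auto simp: brandt_carrier_def brandt_unit_def)
qed

text \<open>Each element has at most one non-zero entry, so it suffices to compare \<open>p\<close>
  and \<open>q\<close> at their own two positions: agreement at both forces equal positions and
  equal values, or two zeros.\<close>

lemma entries_distinguish:
  assumes "p \<in> B" "q \<in> B" "p \<noteq> q"
  shows "\<exists>\<alpha>\<in>I. \<exists>\<beta>\<in>I. entry \<alpha> \<beta> p \<noteq> entry \<alpha> \<beta> q"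
proof -
  obtain \<alpha> \<beta> s where p: "\<alpha> \<in> I" "\<beta> \<in> I" "p = unit \<alpha> \<beta> s"
    using assms(1) by (rule B_cases)
  obtain \<gamma> \<delta> t where q: "\<gamma> \<in> I" "\<delta> \<in> I" "q = unit \<gamma> \<delta> t"
    using assms(2) by (rule B_cases)
  have "entry \<alpha> \<beta> p \<noteq> entry \<alpha> \<beta> q \<or> entry \<gamma> \<delta> p \<noteq> entry \<gamma> \<delta> q"
    using assms(3) by (auto simp: p q split: if_splits)
  with p q show ?thesis by blast
qed

text \<open>With the next lemma this replaces the sum in a matrix product, since S has no addition.
  The index \<delta> is the common inner index, without which the product vanishes.\<close>

lemma entry_mult:
  "p \<in> B \<Longrightarrow> q \<in> B \<Longrightarrow> entry \<alpha> \<beta> (p \<odot> q) \<noteq> z \<Longrightarrow>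
     \<exists>\<delta>\<in>I. entry \<alpha> \<beta> (p \<odot> q) = entry \<alpha> \<delta> p \<otimes> entry \<delta> \<beta> q"
  by (auto simp: brandt_carrier_def split: if_splits)

lemma entry_mult_nonzero:
  "p \<in> B \<Longrightarrow> q \<in> B \<Longrightarrow> entry \<alpha> \<delta> p \<otimes> entry \<delta> \<beta> q \<noteq> z \<Longrightarrow>
     entry \<alpha> \<beta> (p \<odot> q) = entry \<alpha> \<delta> p \<otimes> entry \<delta> \<beta> q"
  by (auto simp: brandt_carrier_def split: if_splits)

lemma unit_mult:
  assumes "s \<in> carrier S" "t \<in> carrier S"
  shows "unit \<alpha> \<beta> s \<odot> unit \<gamma> \<delta> t = (if \<beta> = \<gamma> then unit \<alpha> \<delta> (s \<otimes> t) else None)"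
  using assms by (auto simp: brandt_unit_def)

lemma None_mult [simp]: "None \<odot> p = None" "p \<odot> None = None"
  by (cases p; simp)+

lemma mult_closed_B: "p \<in> B \<Longrightarrow> q \<in> B \<Longrightarrow> p \<odot> q \<in> B"
  by (elim B_cases) (simp add: unit_mult)

lemma semigroup_B: "semigroup_on B (brandt_mult S z)"
  unfolding semigroup_on_def
proof (intro conjI ballI)
  fix p q r assume "p \<in> B" "q \<in> B" "r \<in> B"
  then show "p \<odot> q \<odot> r = p \<odot> (q \<odot> r)"
    by (elim B_cases) (auto simp: unit_mult m_assoc)
qed (rule mult_closed_B)

text \<open>Here the identity of S enters: the left factor selects row \<alpha> and moves it to
  \<gamma>, the right factor selects column \<beta> and moves it to \<delta>.\<close>

lemma unit_mult_entry:
  assumes "p \<in> B"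
  shows "unit \<gamma> \<alpha> \<one> \<odot> p \<odot> unit \<beta> \<delta> \<one> = unit \<gamma> \<delta> (entry \<alpha> \<beta> p)"
  using assms by (elim B_cases) (auto simp: unit_mult)

lemma block_carrier: "brandt_block z (carrier S) \<alpha> \<beta> = unit \<alpha> \<beta> ` carrier S"
  by (auto simp: brandt_block_def brandt_unit_def image_iff)

section \<open>Open sets described by their traces on the blocks\<close>

abbreviation trace :: "'i \<Rightarrow> 'i \<Rightarrow> ('i \<times> 's \<times> 'i) option set \<Rightarrow> 's set" where
  "trace \<alpha> \<beta> W \<equiv> {s \<in> carrier S. unit \<alpha> \<beta> s \<in> W}"

text \<open>A non-zero \<open>p\<close> is decided by its only non-zero entry; for
  \<open>None\<close> all entries are \<open>z\<close>, and \<open>z\<close> lies in a trace of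
  \<open>W\<close> iff \<open>None\<close> lies in \<open>W\<close>. The second disjunct does not
  demand \<open>p = None\<close>, as it implies membership for every \<open>p\<close>; thus both
  disjuncts become open conditions on \<open>p\<close> when the traces are open.\<close>

lemma mem_iff_entries:
  assumes "p \<in> B"
  shows "p \<in> W \<longleftrightarrow> (\<exists>\<alpha>\<in>I. \<exists>\<beta>\<in>I. entry \<alpha> \<beta> p \<in> trace \<alpha> \<beta> W - {z}) \<or>
    None \<in> W \<and> (\<forall>\<alpha>\<in>I. \<forall>\<beta>\<in>I. entry \<alpha> \<beta> p \<in> trace \<alpha> \<beta> W)"
  using assms
proof (rule B_cases)
  fix \<alpha> \<beta> s assume *: "\<alpha> \<in> I" "\<beta> \<in> I" "s \<in> carrier S" "p = unit \<alpha> \<beta> s"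
  then show ?thesis
    by (cases "s = z") (auto split: if_splits)
qed

text \<open>The membership criterion is pulled back along \<open>g\<close>. No topology on
  \<open>B\<close> enters, so the lemma serves both for the identity, to recognise open sets, and
  for an arbitrary \<open>g\<close>, to prove continuity.\<close>

lemma openin_preimage_if_entries_continuous:
  assumes g: "\<And>y. y \<in> topspace Y \<Longrightarrow> g y \<in> B"
    and cont: "\<And>\<alpha> \<beta>. \<alpha> \<in> I \<Longrightarrow> \<beta> \<in> I \<Longrightarrow> continuous_map Y T (\<lambda>y. entry \<alpha> \<beta> (g y))"
    and W: "\<And>\<alpha> \<beta>. \<alpha> \<in> I \<Longrightarrow> \<beta> \<in> I \<Longrightarrow> openin T (trace \<alpha> \<beta> W)"
  shows "openin Y {y \<in> topspace Y. g y \<in> W}"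
proof -
  let ?N = "\<lambda>\<alpha> \<beta>. {y \<in> topspace Y. entry \<alpha> \<beta> (g y) \<in> trace \<alpha> \<beta> W - {z}}"
  let ?P = "\<lambda>\<alpha> \<beta>. {y \<in> topspace Y. entry \<alpha> \<beta> (g y) \<in> trace \<alpha> \<beta> W}"
  have "openin Y (?N \<alpha> \<beta>)" if "\<alpha> \<in> I" "\<beta> \<in> I" for \<alpha> \<beta>
    using that by (intro continuous_map_preimage_diff_point[OF cont t1_T W]) simp_all
  then have N: "openin Y (\<Union>\<alpha>\<in>I. \<Union>\<beta>\<in>I. ?N \<alpha> \<beta>)"
    by (blast intro: openin_Union)
  \<comment> \<open>Finiteness of \<open>I\<close> is decisive here: a finite intersection of open
    sets is open.\<close>
  have P: "openin Y (\<Inter>\<alpha>\<in>I. \<Inter>\<beta>\<in>I. ?P \<alpha> \<beta>)"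
    using finite_index index_nonempty
    by (intro openin_INT2 openin_continuous_map_preimage[OF cont] W) auto
  have "{y \<in> topspace Y. g y \<in> W} =
      (\<Union>\<alpha>\<in>I. \<Union>\<beta>\<in>I. ?N \<alpha> \<beta>) \<union> (if None \<in> W then \<Inter>\<alpha>\<in>I. \<Inter>\<beta>\<in>I. ?P \<alpha> \<beta> else {})"
    (is "?L = ?R")
  proof (rule Set.set_eqI)
    fix y
    show "y \<in> ?L \<longleftrightarrow> y \<in> ?R"
    proof (cases "y \<in> topspace Y")
      case True
      with mem_iff_entries[OF g[OF True], of W] show ?thesis by simp
    next
      case False
      with index_nonempty show ?thesis by auto
    qed
  qed
  with N P show ?thesis by (auto intro: openin_Un)
qed

section \<open>The topology determined by insertions and entries\<close>

text \<open>Stated as a property rather than as a construction, so that it can be verified for any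
  given Brandt extension; it turns out to hold for exactly one topology.\<close>

definition coordinate_topology :: "('i \<times> 's \<times> 'i) option topology \<Rightarrow> bool" where
  "coordinate_topology X \<longleftrightarrow> topspace X = B \<and>
     (\<forall>\<alpha>\<in>I. \<forall>\<beta>\<in>I. continuous_map T X (unit \<alpha> \<beta>) \<and> continuous_map X T (entry \<alpha> \<beta>))"

lemma coordinate_topologyD:
  assumes "coordinate_topology X"
  shows "topspace X = B"
    and "\<alpha> \<in> I \<Longrightarrow> \<beta> \<in> I \<Longrightarrow> continuous_map T X (unit \<alpha> \<beta>)"
    and "\<alpha> \<in> I \<Longrightarrow> \<beta> \<in> I \<Longrightarrow> continuous_map X T (entry \<alpha> \<beta>)"
  using assms by (auto simp: coordinate_topology_def)

text \<open>Continuity of the insertions makes all traces of an open set open; continuity of the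
  entries gives the converse, by the preimage lemma for the identity. The open sets do not depend on
  \<open>X\<close>, hence uniqueness.\<close>

lemma openin_coordinate_topology:
  assumes "coordinate_topology X"
  shows "openin X W \<longleftrightarrow> W \<subseteq> B \<and> (\<forall>\<alpha>\<in>I. \<forall>\<beta>\<in>I. openin T (trace \<alpha> \<beta> W))"
proof safe
  fix p assume "openin X W" "p \<in> W"
  then show "p \<in> B"
    using coordinate_topologyD(1)[OF assms] openin_subset by fastforce
next
  fix \<alpha> \<beta> assume "openin X W" "\<alpha> \<in> I" "\<beta> \<in> I"
  then show "openin T (trace \<alpha> \<beta> W)"
    using openin_continuous_map_preimage[OF coordinate_topologyD(2)[OF assms]] by fastforce
next
  assume W: "W \<subseteq> B" "\<forall>\<alpha>\<in>I. \<forall>\<beta>\<in>I. openin T (trace \<alpha> \<beta> W)"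
  have "openin X {p \<in> topspace X. p \<in> W}"
    by (rule openin_preimage_if_entries_continuous)
      (use W in \<open>auto simp: coordinate_topologyD[OF assms]\<close>)
  also have "{p \<in> topspace X. p \<in> W} = W"
    using W by (auto simp: coordinate_topologyD[OF assms])
  finally show "openin X W" .
qed

lemma coordinate_topology_unique:
  "coordinate_topology X \<Longrightarrow> coordinate_topology Y \<Longrightarrow> X = Y"
  by (auto simp: topology_eq openin_coordinate_topology)

lemma continuous_map_into_coordinate_topology:
  assumes X: "coordinate_topology X"
    and g: "\<And>y. y \<in> topspace Y \<Longrightarrow> g y \<in> B"
    and cont: "\<And>\<alpha> \<beta>. \<alpha> \<in> I \<Longrightarrow> \<beta> \<in> I \<Longrightarrow> continuous_map Y T (\<lambda>y. entry \<alpha> \<beta> (g y))"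
  shows "continuous_map Y X g"
  unfolding continuous_map_def
proof (intro conjI allI impI)
  show "g \<in> topspace Y \<rightarrow> topspace X"
    using g coordinate_topologyD(1)[OF X] by auto
next
  fix W assume "openin X W"
  then show "openin Y {y \<in> topspace Y. g y \<in> W}"
    by (intro openin_preimage_if_entries_continuous g cont)
      (auto simp: openin_coordinate_topology[OF X])
qed

text \<open>The witness is the final topology for the insertions, which are then continuous by
  construction; only the entries need an argument.\<close>

lemma coordinate_topology_exists: "\<exists>X. coordinate_topology X"
proof -
  define Q where "Q W \<longleftrightarrow> W \<subseteq> B \<and> (\<forall>\<alpha>\<in>I. \<forall>\<beta>\<in>I. openin T (trace \<alpha> \<beta> W))" for W
  have "istopology Q"
    unfolding istopology_def
  proof (intro conjI allI impI)
    fix V W assume VW: "Q V" "Q W"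
    have "trace \<alpha> \<beta> (V \<inter> W) = trace \<alpha> \<beta> V \<inter> trace \<alpha> \<beta> W" for \<alpha> \<beta>
      by auto
    with VW show "Q (V \<inter> W)"
      by (auto simp: Q_def)
  next
    fix \<W> assume W: "\<forall>W\<in>\<W>. Q W"
    have "trace \<alpha> \<beta> (\<Union>\<W>) = (\<Union>W\<in>\<W>. trace \<alpha> \<beta> W)" for \<alpha> \<beta>
      by auto
    with W show "Q (\<Union>\<W>)"
      by (auto simp: Q_def intro!: openin_Union)
  qed
  define X where "X = topology Q"
  have open_X: "openin X W \<longleftrightarrow> Q W" for W
    using \<open>istopology Q\<close> by (simp add: X_def topology_inverse')
  have "trace \<alpha> \<beta> B = topspace T" if "\<alpha> \<in> I" "\<beta> \<in> I" for \<alpha> \<beta>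
    using that by auto
  then have "Q B"
    by (auto simp: Q_def simp del: topspace_T)
  then have topspace_X: "topspace X = B"
    unfolding topspace_def open_X by (auto simp: Q_def)
  have "continuous_map T X (unit \<alpha> \<beta>)" if "\<alpha> \<in> I" "\<beta> \<in> I" for \<alpha> \<beta>
    using that by (auto simp: continuous_map_def open_X Q_def topspace_X)
  moreover have "continuous_map X T (entry \<alpha> \<beta>)" if "\<alpha> \<in> I" "\<beta> \<in> I" for \<alpha> \<beta>
    unfolding continuous_map_def open_X topspace_X
  proof (intro conjI allI impI)
    fix V assume V: "openin T V"
    \<comment> \<open>An entry composed with an insertion is the identity if the positions agree and
      the constant \<open>z\<close> otherwise.\<close>
    have "trace \<gamma> \<delta> {p \<in> B. entry \<alpha> \<beta> p \<in> V} =
        (if \<alpha> = \<gamma> \<and> \<beta> = \<delta> then V else if z \<in> V then topspace T else {})"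
      if "\<gamma> \<in> I" "\<delta> \<in> I" for \<gamma> \<delta>
      using that openin_subset[OF V] by auto
    with V show "Q {p \<in> B. entry \<alpha> \<beta> p \<in> V}"
      by (auto simp: Q_def simp del: topspace_T)
  qed auto
  ultimately show ?thesis
    using topspace_X unfolding coordinate_topology_def by blast
qed

text \<open>Distinct elements differ in some entry; disjoint neighbourhoods of the two values in S
  are pulled back along that continuous entry.\<close>

lemma Hausdorff_coordinate_topology:
  assumes X: "coordinate_topology X"
  shows "Hausdorff_space X"
  unfolding Hausdorff_space_def
proof (intro allI impI)
  fix p q assume pq: "p \<in> topspace X \<and> q \<in> topspace X \<and> p \<noteq> q"
  then have B: "p \<in> B" "q \<in> B"
    by (auto simp: coordinate_topologyD[OF X])
  then obtain \<alpha> \<beta> where ab: "\<alpha> \<in> I" "\<beta> \<in> I" "entry \<alpha> \<beta> p \<noteq> entry \<alpha> \<beta> q"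
    using entries_distinguish pq by blast
  then obtain U V where UV: "openin T U" "openin T V" "entry \<alpha> \<beta> p \<in> U" "entry \<alpha> \<beta> q \<in> V" "disjnt U V"
    using Hausdorff_T B unfolding Hausdorff_space_def by (metis entry_closed topspace_T)
  note pre = openin_continuous_map_preimage[OF coordinate_topologyD(3)[OF X ab(1,2)]]
  show "\<exists>U V. openin X U \<and> openin X V \<and> p \<in> U \<and> q \<in> V \<and> disjnt U V"
    using pre[OF UV(1)] pre[OF UV(2)] UV pq
    by (intro exI[of _ "{x \<in> topspace X. entry \<alpha> \<beta> x \<in> U}"]
        exI[of _ "{x \<in> topspace X. entry \<alpha> \<beta> x \<in> V}"]) (auto simp: disjnt_iff)
qed

text \<open>
  The \<open>(\<alpha>, \<beta>)\<close> entry of a product is a matrix product entry in which at most one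
  summand is non-zero.
\<close>

lemma continuous_mult_coordinate_topology:
  assumes X: "coordinate_topology X"
  shows "continuous_map (prod_topology X X) X (\<lambda>(p, q). p \<odot> q)"
proof (rule continuous_map_into_coordinate_topology[OF X])
  fix y assume "y \<in> topspace (prod_topology X X)"
  then show "(case y of (p, q) \<Rightarrow> p \<odot> q) \<in> B"
    by (auto simp: coordinate_topologyD[OF X] mult_closed_B)
next
  fix \<alpha> \<beta> assume ab: "\<alpha> \<in> I" "\<beta> \<in> I"
  let ?Y = "prod_topology X X"
  let ?m = "\<lambda>y. entry \<alpha> \<beta> (case y of (p, q) \<Rightarrow> p \<odot> q)"
  let ?s = "\<lambda>\<delta> y. entry \<alpha> \<delta> (fst y) \<otimes> entry \<delta> \<beta> (snd y)"
  have s: "continuous_map ?Y T (?s \<delta>)" if "\<delta> \<in> I" for \<delta>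
  proof (rule continuous_map_mult)
    show "continuous_map ?Y T (\<lambda>y. entry \<alpha> \<delta> (fst y))"
      using continuous_map_compose[OF continuous_map_fst coordinate_topologyD(3)[OF X ab(1) that]]
      by (simp add: o_def)
    show "continuous_map ?Y T (\<lambda>y. entry \<delta> \<beta> (snd y))"
      using continuous_map_compose[OF continuous_map_snd coordinate_topologyD(3)[OF X that ab(2)]]
      by (simp add: o_def)
  qed
  show "continuous_map ?Y T ?m"
    unfolding continuous_map_def
  proof (intro conjI allI impI)
    show "?m \<in> topspace ?Y \<rightarrow> topspace T"
      by (auto simp: coordinate_topologyD[OF X] mult_closed_B)
  next
    fix V assume V: "openin T V"
    \<comment> \<open>The entry of the product lies in \<open>V\<close> iff some non-zero summand
      does, or \<open>z\<close> is in \<open>V\<close> and all summands lie in \<open>V\<close>.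
      This covers \<open>z\<close> without requiring the summands to vanish, so both conditions are
      open.\<close>
    let ?N = "\<lambda>\<delta>. {y \<in> topspace ?Y. ?s \<delta> y \<in> V - {z}}"
    let ?P = "\<lambda>\<delta>. {y \<in> topspace ?Y. ?s \<delta> y \<in> V}"
    have "openin ?Y (?N \<delta>)" if "\<delta> \<in> I" for \<delta>
      by (intro continuous_map_preimage_diff_point[OF s[OF that] t1_T V]) simp
    then have N: "openin ?Y (\<Union>\<delta>\<in>I. ?N \<delta>)"
      by (blast intro: openin_Union)
    have P: "openin ?Y (\<Inter>\<delta>\<in>I. ?P \<delta>)"
      using finite_index index_nonempty
      by (intro openin_INT2 openin_continuous_map_preimage[OF s] V) auto
    have "{y \<in> topspace ?Y. ?m y \<in> V} = (\<Union>\<delta>\<in>I. ?N \<delta>) \<union> (if z \<in> V then \<Inter>\<delta>\<in>I. ?P \<delta> else {})"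
      (is "?L = ?R")
    proof (rule Set.set_eqI)
      fix y
      show "y \<in> ?L \<longleftrightarrow> y \<in> ?R"
      proof (cases "y \<in> topspace ?Y")
        case False
        with index_nonempty show ?thesis by auto
      next
        case True
        then obtain p q where y: "y = (p, q)" "p \<in> B" "q \<in> B"
          by (auto simp: coordinate_topologyD[OF X])
        show ?thesis
        proof (cases "\<exists>\<delta>\<in>I. ?s \<delta> y \<noteq> z")
          case nonzero: True
          then obtain \<delta> where d: "\<delta> \<in> I" "?s \<delta> y \<noteq> z" by blast
          \<comment> \<open>Every non-zero summand equals the entry of the product, so all non-zero
            summands agree and either condition puts the entry in \<open>V\<close>.\<close>
          have m: "?m y = ?s \<epsilon> y" if "?s \<epsilon> y \<noteq> z" for \<epsilon>
            using entry_mult_nonzero[OF y(2,3), of \<alpha> \<epsilon> \<beta>] that by (simp add: y)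
          show ?thesis
            using True d m[OF d(2)] m by (auto; metis)
        next
          case zero: False
          then have "?m y = z"
            using entry_mult[OF y(2,3), of \<alpha> \<beta>] y(1) by auto
          with True zero index_nonempty show ?thesis by auto
        qed
      qed
    qed
    with N P show "openin ?Y {y \<in> topspace ?Y. ?m y \<in> V}"
      by (auto intro: openin_Un)
  qed
qed

section \<open>Brandt extensions are exactly the coordinate topologies\<close>

text \<open>The diagonal entry is a continuous inverse of the diagonal insertion, which is therefore
  a homeomorphism onto its block.\<close>

lemma brandt_extension_if_coordinate_topology:
  assumes X: "coordinate_topology X"
  shows "topological_brandt_extension I S z T X"
proof -
  obtain \<alpha> where a: "\<alpha> \<in> I" using index_nonempty by blast
  let ?X = "subtopology X (brandt_block z (carrier S) \<alpha> \<alpha>)"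
  have "homeomorphic_maps T ?X (unit \<alpha> \<alpha>) (entry \<alpha> \<alpha>)"
    unfolding homeomorphic_maps_def
    using coordinate_topologyD(2,3)[OF X a a]
    by (auto simp: continuous_map_in_subtopology continuous_map_from_subtopology block_carrier)
  then have "homeomorphic_map T ?X (brandt_embed z \<alpha>)"
    unfolding brandt_embed_eq_unit homeomorphic_map_maps by blast
  then show ?thesis
    unfolding topological_brandt_extension_def extends_topology_def topological_semigroup_def
    using a semigroup_B coordinate_topologyD(1)[OF X] Hausdorff_coordinate_topology[OF X]
      continuous_mult_coordinate_topology[OF X]
    by blast
qed

text \<open>Only one diagonal block is known to carry the topology of S; two-sided translations by
  matrix units, continuous since multiplication is, spread this to all blocks.\<close>

lemma coordinate_topology_if_brandt_extension:
  assumes "topological_brandt_extension I S z T X"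
  shows "coordinate_topology X"
proof -
  have topspace_X [simp]: "topspace X = B"
    and mult: "continuous_map (prod_topology X X) X (\<lambda>(p, q). p \<odot> q)"
    using assms by (auto simp: topological_brandt_extension_def topological_semigroup_def)
  obtain \<alpha>0 where a0: "\<alpha>0 \<in> I" and hom:
    "homeomorphic_map T (subtopology X (brandt_block z (carrier S) \<alpha>0 \<alpha>0)) (unit \<alpha>0 \<alpha>0)"
    using assms by (auto simp: topological_brandt_extension_def extends_topology_def
        brandt_embed_eq_unit)
  let ?X = "subtopology X (brandt_block z (carrier S) \<alpha>0 \<alpha>0)"
  have translate: "continuous_map Y X (\<lambda>y. a \<odot> f y \<odot> b)"
    if "continuous_map Y X f" "a \<in> B" "b \<in> B"
    for Y :: "'y topology" and f a b
  proof -
    have "continuous_map Y (prod_topology X X) (\<lambda>y. (a, f y))"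
      using that by (simp add: continuous_map_pairedI)
    from continuous_map_compose[OF this mult]
    have "continuous_map Y X (\<lambda>y. a \<odot> f y)" by (simp add: o_def)
    then have "continuous_map Y (prod_topology X X) (\<lambda>y. (a \<odot> f y, b))"
      using that by (simp add: continuous_map_pairedI)
    from continuous_map_compose[OF this mult] show ?thesis
      by (simp add: o_def)
  qed
  have unit0: "continuous_map T X (unit \<alpha>0 \<alpha>0)"
    using homeomorphic_imp_continuous_map[OF hom] by (simp add: continuous_map_in_subtopology)
  \<comment> \<open>\<open>h\<close> reads off the entry at the known block and is continuous on
    that subspace.\<close>
  obtain h where h: "continuous_map ?X T h" "\<And>s. s \<in> carrier S \<Longrightarrow> h (unit \<alpha>0 \<alpha>0 s) = s"
    using hom by (auto simp: homeomorphic_map_maps homeomorphic_maps_def)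
  have "continuous_map T X (unit \<alpha> \<beta>)" if ab: "\<alpha> \<in> I" "\<beta> \<in> I" for \<alpha> \<beta>
  proof (rule continuous_map_eq)
    \<comment> \<open>Insert into the known block first, then translate to position (\<alpha>,
      \<beta>).\<close>
    show "continuous_map T X (\<lambda>s. unit \<alpha> \<alpha>0 \<one> \<odot> unit \<alpha>0 \<alpha>0 s \<odot> unit \<alpha>0 \<beta> \<one>)"
      using ab a0 by (intro translate unit0) auto
  qed (simp add: unit_mult)
  moreover have "continuous_map X T (entry \<alpha> \<beta>)" if ab: "\<alpha> \<in> I" "\<beta> \<in> I" for \<alpha> \<beta>
  proof -
    \<comment> \<open>Translate the (\<alpha>, \<beta>) entry into the known block, where
      \<open>h\<close> can read it.\<close>
    have "continuous_map X X (\<lambda>p. unit \<alpha>0 \<alpha> \<one> \<odot> p \<odot> unit \<beta> \<alpha>0 \<one>)"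
      using translate[OF continuous_map_id, of "unit \<alpha>0 \<alpha> \<one>" "unit \<beta> \<alpha>0 \<one>"] ab a0
      by simp
    then have "continuous_map X X (\<lambda>p. unit \<alpha>0 \<alpha>0 (entry \<alpha> \<beta> p))"
      by (rule continuous_map_eq) (simp add: unit_mult_entry)
    then have "continuous_map X ?X (\<lambda>p. unit \<alpha>0 \<alpha>0 (entry \<alpha> \<beta> p))"
      by (auto simp: continuous_map_in_subtopology block_carrier)
    from continuous_map_compose[OF this h(1)] show ?thesis
      by (rule continuous_map_eq) (simp add: h(2))
  qed
  ultimately show ?thesis
    by (simp add: coordinate_topology_def)
qed

section \<open>The explicit base\<close>

lemma coordinate_topology_base:
  assumes X: "coordinate_topology X" and BS: "\<forall>s\<in>carrier S. open_base_at T s (BS s)"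
  shows "openin X = arbitrary union_of (\<lambda>W. W \<in> brandt_base I S z BS)"
  unfolding openin_topology_base_unique
proof safe
  fix W assume "W \<in> brandt_base I S z BS"
  then obtain t where t: "t \<in> B" "W \<in> brandt_base_at I z BS t"
    by (auto simp: brandt_base_def)
  show "openin X W"
  proof (cases t)
    case None
    then obtain U where U: "U \<in> BS z" "W = (\<Union>\<alpha>\<in>I. \<Union>\<beta>\<in>I. brandt_block z U \<alpha> \<beta>)"
      using t by auto
    have "openin T U" "z \<in> U"
      using BS U(1) by (auto simp: open_base_at_def)
    then have "U \<subseteq> carrier S" using openin_subset by fastforce
    \<comment> \<open>A basic neighbourhood of zero has the same trace \<open>U\<close> on every
      block.\<close>
    have "trace \<alpha> \<beta> W = U" if "\<alpha> \<in> I" "\<beta> \<in> I" for \<alpha> \<beta>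
      using that \<open>z \<in> U\<close> \<open>U \<subseteq> carrier S\<close>
      by (auto simp: U(2) brandt_block_def brandt_unit_def split: if_splits)
    moreover have "W \<subseteq> B"
      using \<open>z \<in> U\<close> \<open>U \<subseteq> carrier S\<close> by (auto simp: U(2) brandt_block_def brandt_carrier_def)
    ultimately show ?thesis
      using \<open>openin T U\<close> by (simp add: openin_coordinate_topology[OF X])
  next
    case (Some q)
    then obtain \<alpha> s \<beta> where q: "t = Some (\<alpha>, s, \<beta>)" "\<alpha> \<in> I" "\<beta> \<in> I" "s \<in> carrier S"
      using t(1) by (auto simp: brandt_carrier_def)
    then obtain U where U: "U \<in> BS s" "W = brandt_block z U \<alpha> \<beta> - {None}"
      using t by auto
    have "openin T U"
      using BS U(1) q by (auto simp: open_base_at_def)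
    then have "U \<subseteq> carrier S" using openin_subset by fastforce
    \<comment> \<open>Removing \<open>None\<close> from the block removes \<open>z\<close> from its
      trace and empties all other traces; \<open>U - {z}\<close> stays open because points are
      closed.\<close>
    have "trace \<gamma> \<delta> W = (if \<alpha> = \<gamma> \<and> \<beta> = \<delta> then U - {z} else {})" for \<gamma> \<delta>
      using \<open>U \<subseteq> carrier S\<close>
      by (auto simp: U(2) brandt_block_def brandt_unit_def split: if_splits)
    moreover have "openin T (U - {z})"
      using \<open>openin T U\<close> by (simp add: openin_diff closedin_t1_singleton t1_T)
    moreover have "W \<subseteq> B"
      using q \<open>U \<subseteq> carrier S\<close>
      by (auto simp: U(2) brandt_block_def brandt_carrier_def split: if_splits)
    ultimately show ?thesis
      by (simp add: openin_coordinate_topology[OF X])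
  qed
next
  fix W x assume W: "openin X W" "x \<in> W"
  then have traces: "\<And>\<alpha> \<beta>. \<alpha> \<in> I \<Longrightarrow> \<beta> \<in> I \<Longrightarrow> openin T (trace \<alpha> \<beta> W)" and "x \<in> B"
    by (auto simp: openin_coordinate_topology[OF X])
  have "\<exists>V\<in>brandt_base_at I z BS x. x \<in> V \<and> V \<subseteq> W"
  proof (cases x)
    case None
    \<comment> \<open>One \<open>U\<close> has to serve all blocks at once, so it is chosen inside
      the intersection of all traces, a neighbourhood of \<open>z\<close> as \<open>I\<close> is
      finite.\<close>
    have "openin T (\<Inter>\<alpha>\<in>I. \<Inter>\<beta>\<in>I. trace \<alpha> \<beta> W)"
      using finite_index index_nonempty traces by (intro openin_INT2) auto
    moreover have "z \<in> (\<Inter>\<alpha>\<in>I. \<Inter>\<beta>\<in>I. trace \<alpha> \<beta> W)"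
      using W(2) None by simp
    ultimately obtain U where U: "U \<in> BS z" "U \<subseteq> (\<Inter>\<alpha>\<in>I. \<Inter>\<beta>\<in>I. trace \<alpha> \<beta> W)"
      using BS unfolding open_base_at_def by (meson zero_closed)
    have "z \<in> U" using BS U(1) by (auto simp: open_base_at_def)
    have "(\<Union>\<alpha>\<in>I. \<Union>\<beta>\<in>I. brandt_block z U \<alpha> \<beta>) \<subseteq> W"
    proof safe
      fix \<alpha> \<beta> p assume ab: "\<alpha> \<in> I" "\<beta> \<in> I" and "p \<in> brandt_block z U \<alpha> \<beta>"
      then obtain s where "s \<in> U" "p = unit \<alpha> \<beta> s"
        using \<open>z \<in> U\<close> by (auto simp: brandt_block_def brandt_unit_def)
      with U(2) ab show "p \<in> W" by auto
    qed
    moreover have "None \<in> (\<Union>\<alpha>\<in>I. \<Union>\<beta>\<in>I. brandt_block z U \<alpha> \<beta>)"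
      using \<open>z \<in> U\<close> index_nonempty by (auto simp: brandt_block_def)
    ultimately show ?thesis
      using None U(1) by auto
  next
    case (Some q)
    then obtain \<alpha> s \<beta> where q: "x = Some (\<alpha>, s, \<beta>)" "\<alpha> \<in> I" "\<beta> \<in> I" "s \<in> carrier S" "s \<noteq> z"
      using \<open>x \<in> B\<close> by (auto simp: brandt_carrier_def)
    then have "s \<in> trace \<alpha> \<beta> W"
      using W(2) by (simp add: brandt_unit_def)
    then obtain U where U: "U \<in> BS s" "U \<subseteq> trace \<alpha> \<beta> W"
      using BS traces[OF q(2,3)] unfolding open_base_at_def by (meson q(4))
    have "s \<in> U" using BS U(1) q(4) by (auto simp: open_base_at_def)
    have "brandt_block z U \<alpha> \<beta> - {None} \<subseteq> W"
      using U(2) by (auto simp: brandt_block_def brandt_unit_def split: if_splits)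
    moreover have "x \<in> brandt_block z U \<alpha> \<beta> - {None}"
      using q \<open>s \<in> U\<close> by (auto simp: brandt_block_def)
    ultimately show ?thesis
      using q(1) U(1) by auto
  qed
  then show "\<exists>V. V \<in> brandt_base I S z BS \<and> x \<in> V \<and> V \<subseteq> W"
    using \<open>x \<in> B\<close> by (auto simp: brandt_base_def)
qed

section \<open>Inverses and inversion\<close>

lemma inverse_of_zero: "inverse_of (carrier S) (mult S) z t \<longleftrightarrow> t = z"
  by (auto simp: inverse_of_def)

text \<open>An inverse must sit at the transposed position, as otherwise the triple products vanish;
  there the equations reduce to those in S.\<close>

lemma inverse_of_unit:
  assumes I: "\<alpha> \<in> I" "\<beta> \<in> I" and s: "s \<in> carrier S"
  shows "inverse_of B (brandt_mult S z) (unit \<alpha> \<beta> s) p \<longleftrightarrow>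
    (\<exists>t. inverse_of (carrier S) (mult S) s t \<and> p = unit \<beta> \<alpha> t)"
proof
  assume L: "inverse_of B (brandt_mult S z) (unit \<alpha> \<beta> s) p"
  then have "p \<in> B" by (simp add: inverse_of_def)
  then show "\<exists>t. inverse_of (carrier S) (mult S) s t \<and> p = unit \<beta> \<alpha> t"
  proof (rule B_cases)
    fix \<gamma> \<delta> t assume p: "\<gamma> \<in> I" "\<delta> \<in> I" "t \<in> carrier S" "p = unit \<gamma> \<delta> t"
    show ?thesis
    proof (cases "\<gamma> = \<beta> \<and> \<delta> = \<alpha>")
      case True
      then have "unit \<alpha> \<beta> (s \<otimes> t \<otimes> s) = unit \<alpha> \<beta> s" "unit \<beta> \<alpha> (t \<otimes> s \<otimes> t) = unit \<beta> \<alpha> t"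
        using L p s by (auto simp: inverse_of_def unit_mult)
      then have "s \<otimes> t \<otimes> s = s" "t \<otimes> s \<otimes> t = t"
        by (auto simp: brandt_unit_def split: if_splits)
      with True p show ?thesis
        by (auto simp: inverse_of_def)
    next
      case False
      \<comment> \<open>Both triple products are \<open>None\<close>, so both elements are zero, and
        zero is also the unit with entry \<open>z\<close> at the transposed position.\<close>
      then have "s = z" "t = z"
        using L p s by (auto simp: inverse_of_def unit_mult split: if_splits)
      with p show ?thesis by (auto simp: inverse_of_zero)
    qed
  qed
next
  assume "\<exists>t. inverse_of (carrier S) (mult S) s t \<and> p = unit \<beta> \<alpha> t"
  then show "inverse_of B (brandt_mult S z) (unit \<alpha> \<beta> s) p"
    using I s by (auto simp: inverse_of_def unit_mult)
qed

lemma unit_inject: "unit \<alpha> \<beta> s = unit \<alpha> \<beta> t \<longleftrightarrow> s = t"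
  by (auto simp: brandt_unit_def)

lemma ex1_inverse_of_unit:
  assumes "\<alpha> \<in> I" "\<beta> \<in> I" "s \<in> carrier S"
  shows "(\<exists>!p. inverse_of B (brandt_mult S z) (unit \<alpha> \<beta> s) p) \<longleftrightarrow>
    (\<exists>!t. inverse_of (carrier S) (mult S) s t)"
  unfolding inverse_of_unit[OF assms]
proof
  assume "\<exists>!p. \<exists>t. inverse_of (carrier S) (mult S) s t \<and> p = unit \<beta> \<alpha> t"
  then show "\<exists>!t. inverse_of (carrier S) (mult S) s t"
    by (blast dest: unit_inject[THEN iffD1])
next
  assume "\<exists>!t. inverse_of (carrier S) (mult S) s t"
  then show "\<exists>!p. \<exists>t. inverse_of (carrier S) (mult S) s t \<and> p = unit \<beta> \<alpha> t"
    by blast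
qed

text \<open>Insertions are injective, so unique inverses transfer in both directions: every element
  of \<open>B\<close> is a unit, and one diagonal block already contains all of S.\<close>

lemma inverse_semigroup_B_iff:
  "inverse_semigroup_on B (brandt_mult S z) \<longleftrightarrow> inverse_semigroup_on (carrier S) (mult S)"
proof -
  have "(\<forall>p\<in>B. \<exists>!q. inverse_of B (brandt_mult S z) p q) \<longleftrightarrow>
      (\<forall>s\<in>carrier S. \<exists>!t. inverse_of (carrier S) (mult S) s t)" (is "?L \<longleftrightarrow> ?R")
  proof
    assume L: ?L
    obtain \<alpha> where "\<alpha> \<in> I" using index_nonempty by blast
    show ?R
    proof
      fix s assume "s \<in> carrier S"
      with L \<open>\<alpha> \<in> I\<close> show "\<exists>!t. inverse_of (carrier S) (mult S) s t"
        using ex1_inverse_of_unit[of \<alpha> \<alpha> s] by simp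
    qed
  next
    assume R: ?R
    show ?L
    proof
      fix p assume "p \<in> B"
      then show "\<exists>!q. inverse_of B (brandt_mult S z) p q"
      proof (rule B_cases)
        fix \<alpha> \<beta> s assume "\<alpha> \<in> I" "\<beta> \<in> I" "s \<in> carrier S" "p = unit \<alpha> \<beta> s"
        with R show ?thesis by (simp add: ex1_inverse_of_unit)
      qed
    qed
  qed
  then show ?thesis
    using semigroup_B semigroup_carrier by (simp add: inverse_semigroup_on_def)
qed

abbreviation inv_S :: "'s \<Rightarrow> 's" where
  "inv_S s \<equiv> THE t. inverse_of (carrier S) (mult S) s t"

abbreviation inv_B :: "('i \<times> 's \<times> 'i) option \<Rightarrow> ('i \<times> 's \<times> 'i) option" where
  "inv_B p \<equiv> THE q. inverse_of B (brandt_mult S z) p q"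

lemma inv_S_zero: "inv_S z = z"
  by (simp add: inverse_of_zero)

lemma inverse_of_inv_S:
  assumes "inverse_semigroup_on (carrier S) (mult S)" "s \<in> carrier S"
  shows "inverse_of (carrier S) (mult S) s (inv_S s)"
proof -
  have "\<exists>!t. inverse_of (carrier S) (mult S) s t"
    using assms unfolding inverse_semigroup_on_def by blast
  from theI'[OF this] show ?thesis .
qed

text \<open>Inversion in \<open>B\<close> is transposition combined with inversion of the
  entry.\<close>

lemma inv_B_unit:
  assumes inv: "inverse_semigroup_on (carrier S) (mult S)"
    and "\<alpha> \<in> I" "\<beta> \<in> I" "s \<in> carrier S"
  shows "inv_B (unit \<alpha> \<beta> s) = unit \<beta> \<alpha> (inv_S s)"
proof (rule the1_equality)
  show "\<exists>!p. inverse_of B (brandt_mult S z) (unit \<alpha> \<beta> s) p"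
    using assms by (simp add: ex1_inverse_of_unit inverse_semigroup_on_def)
  show "inverse_of B (brandt_mult S z) (unit \<alpha> \<beta> s) (unit \<beta> \<alpha> (inv_S s))"
    using assms inverse_of_inv_S by (auto simp: inverse_of_unit)
qed

lemma topological_inverse_B_iff:
  assumes X: "coordinate_topology X"
  shows "topological_inverse_semigroup B (brandt_mult S z) X \<longleftrightarrow>
    topological_inverse_semigroup (carrier S) (mult S) T"
proof -
  have "continuous_map X X inv_B \<longleftrightarrow> continuous_map T T inv_S"
    if inv: "inverse_semigroup_on (carrier S) (mult S)"
  proof
    assume cont: "continuous_map X X inv_B"
    obtain \<alpha> where a: "\<alpha> \<in> I" using index_nonempty by blast
    \<comment> \<open>Inversion of S is recovered by inserting into a diagonal block, inverting
      there and reading the entry.\<close>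
    have "continuous_map T T (entry \<alpha> \<alpha> \<circ> (inv_B \<circ> unit \<alpha> \<alpha>))"
      by (intro continuous_map_compose[OF _ coordinate_topologyD(3)[OF X a a]]
          continuous_map_compose[OF coordinate_topologyD(2)[OF X a a] cont])
    then show "continuous_map T T inv_S"
      by (rule continuous_map_eq) (simp add: inv_B_unit[OF inv a a])
  next
    assume cont: "continuous_map T T inv_S"
    have closed: "inv_S s \<in> carrier S" if "s \<in> carrier S" for s
      using inverse_of_inv_S[OF inv that] by (simp add: inverse_of_def)
    show "continuous_map X X inv_B"
    proof (rule continuous_map_into_coordinate_topology[OF X])
      fix p assume "p \<in> topspace X"
      then have "p \<in> B" by (simp add: coordinate_topologyD[OF X])
      then show "inv_B p \<in> B"
        by (rule B_cases) (simp add: inv_B_unit[OF inv] closed)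
    next
      fix \<alpha> \<beta> assume ab: "\<alpha> \<in> I" "\<beta> \<in> I"
      \<comment> \<open>Away from the non-zero position both sides are \<open>z\<close>, because
        \<open>z\<close> is its own inverse in S.\<close>
      have "inv_S (entry \<beta> \<alpha> p) = entry \<alpha> \<beta> (inv_B p)" if "p \<in> B" for p
        using that by (rule B_cases) (auto simp: inv_B_unit[OF inv] inv_S_zero)
      then show "continuous_map X T (\<lambda>p. entry \<alpha> \<beta> (inv_B p))"
        using continuous_map_compose[OF coordinate_topologyD(3)[OF X ab(2,1)] cont]
        by (elim continuous_map_eq) (simp add: coordinate_topologyD[OF X])
    qed
  qed
  moreover have "topological_semigroup B (brandt_mult S z) X"
    using brandt_extension_if_coordinate_topology[OF X]
    by (simp add: topological_brandt_extension_def)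
  moreover have "topological_semigroup (carrier S) (mult S) T"
    using topological_monoid by (simp add: topological_monoid_with_zero_def)
  ultimately show ?thesis
    unfolding topological_inverse_semigroup_def inverse_semigroup_B_iff by blast
qed

end

theorem lemma5p7:
  fixes S :: "('s, 'm) monoid_scheme" and z :: 's and T :: "'s topology" and I :: "'i set"
  assumes "topological_monoid_with_zero S z T"
    and "finite I" and "I \<noteq> {}"
  shows "(\<exists>!TB. topological_brandt_extension I S z T TB) \<and>
    (\<forall>TB. topological_brandt_extension I S z T TB \<longrightarrow>
      (\<forall>BS. (\<forall>s\<in>carrier S. open_base_at T s (BS s)) \<longrightarrow>
         openin TB = arbitrary union_of (\<lambda>W. W \<in> brandt_base I S z BS)) \<and>
      (topological_inverse_semigroup (carrier S) (mult S) T \<longleftrightarrow>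
         topological_inverse_brandt_extension I S z T TB) \<and>
      (topological_inverse_semigroup (carrier S) (mult S) T \<longleftrightarrow>
         topological_inverse_semigroup (brandt_carrier I S z) (brandt_mult S z) TB))"
proof -
  interpret brandt_setting S z T I
    using assms by (rule brandt_setting.intro)
  \<comment> \<open>All claims about Brandt extensions thereby become claims about the one
    coordinate topology.\<close>
  have extension_iff: "topological_brandt_extension I S z T X \<longleftrightarrow> coordinate_topology X" for X
    using brandt_extension_if_coordinate_topology coordinate_topology_if_brandt_extension by blast
  show ?thesis
  proof (intro conjI allI impI)
    show "\<exists>!TB. topological_brandt_extension I S z T TB"
      unfolding extension_iff using coordinate_topology_exists coordinate_topology_unique by blast
  next
    fix TB BS
    assume "topological_brandt_extension I S z T TB"
      and "\<forall>s\<in>carrier S. open_base_at T s (BS s)"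
    then show "openin TB = arbitrary union_of (\<lambda>W. W \<in> brandt_base I S z BS)"
      by (simp add: extension_iff coordinate_topology_base)
  next
    fix TB assume TB: "topological_brandt_extension I S z T TB"
    then show iff: "topological_inverse_semigroup (carrier S) (mult S) T \<longleftrightarrow>
        topological_inverse_semigroup (brandt_carrier I S z) (brandt_mult S z) TB"
      by (simp add: extension_iff topological_inverse_B_iff)
    show "topological_inverse_semigroup (carrier S) (mult S) T \<longleftrightarrow>
        topological_inverse_brandt_extension I S z T TB"
      using TB iff
      by (auto simp: topological_inverse_brandt_extension_def topological_brandt_extension_def)
  qed
qed

end
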